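(* Let $A$, $\xi$, $\zeta$, $\eta=A\xi+\zeta$, $\lambda_k$, $\psi_k$, $\rho_k$, $\nu_k$, $\varepsilon$, $k_I=k_I(\varepsilon)$ and $B_{\mathcal{I}}$ be as defined in the context. If the covariance operator $R_{\xi\xi}$ is of trace class and $\lim_{k\to\infty}\lambda_k\rho_k/\nu_k=0$, then $$\lim_{\varepsilon\to0}\mathrm{E}\left\{\|\xi-B_{\mathcal{I}}\eta\|^2\right\}=\lim_{\varepsilon\to0}\left\{\sum_{k=k_I+1}^\infty\rho_k^2+\sum_{k=1}^{k_I}\left(\frac{\varepsilon\nu_k}{\lambda_k}\right)^2\right\}=0 .$$
   Context: $A$ is an injective self-adjoint compact operator on the (real) Hilbert space $L^2[a,b]$ with simple positive eigenvalues bounded by 1 and tending to 0, and with corresponding eigenfunctions forming an orthonormal basis of $L^2[a,b]$; the eigenvalue and eigenfunction with index $k$ are denoted $\lambda_k$, $\psi_k$, $k=1,2,\dots$ (the numbering is specified below). A zero-mean Gaussian weak random variable $\xi$ in $L^2[a,b]$ is a linear assignment $v\mapsto(\xi,v)$ of jointly Gaussian zero-mean real random variables to the vectors $v\in L^2[a,b]$, with $\mathrm{E}\{(\xi,u)(\xi,v)\}=(R_{\xi\xi}u,v)$ for a bounded self-adjoint nonnegative operator $R_{\xi\xi}$, its covariance operator. Let $\xi$ (signal) and $\zeta$ (noise) be independent zero-mean Gaussian weak random variables in $L^2[a,b]$ with covariance operators $R_{\xi\xi}$ and $R_{\zeta\zeta}=\varepsilon^2N$, where $\varepsilon>0$ is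 a parameter, $N$ is a given operator not depending on $\varepsilon$, and $R_{\zeta\zeta}^{-1}$ exists. Let $\eta=A\xi+\zeta$, i.e. $(\eta,v)=(\xi,Av)+(\zeta,v)$ for all $v$. Write $\xi_k=(\xi,\psi_k)$, $\zeta_k=(\zeta,\psi_k)$, $\eta_k=(\eta,\psi_k)$, so that $\eta_k=\lambda_k\xi_k+\zeta_k$, and let $\rho_k,\nu_k>0$ be given by $\rho_k^2=(R_{\xi\xi}\psi_k,\psi_k)$ and $\varepsilon^2\nu_k^2=(R_{\zeta\zeta}\psi_k,\psi_k)$. It is assumed that the numbers $\lambda_k\rho_k/\nu_k$ are pairwise distinct, and the indices $k$ are numbered (rearranging if necessary, so that the $\lambda_k$ themselves need not be decreasing) so that $\lambda_k\rho_k/\nu_k$ is decreasing in $k$. Let $\mathcal{I}=\{k:\lambda_k\rho_k\geqslant\varepsilon\nu_k\}$; when $\lambda_k\rho_k/\nu_k\to0$ this set is finite and equals $\{1,\dots,k_I\}$, which defines $k_I=k_I(\varepsilon)$ ($k_I=0$ if $\mathcal{I}$ is empty). The operator $B_{\mathcal{I}}:L^2[a,b]\to L^2[a,b]$ is defined by $B_{\mathcal{I}}\psi_k=\lambda_k^{-1}\psi_k$ for $k\leqslant k_I$ and $B_{\mathcal{I}}\psi_k=0$ for $k>k_I$. The mean square error is $\mathrm{E}\{\|\xi-B_{\mathcal{I}}\eta\|^2\}=\sum_{k=1}^{k_I}\mathrm{E}\{|\xi_k-\eta_k/\lambda_k|^2\}+\sum_{k=k_I+1}^\infty\mathrm{E}\{|\xi_k|^2\}$.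 *)

theory Defs
  imports "HOL-Probability.Probability"
begin

section \<open>The Hilbert space of square integrable functions\<close>

definition square_integrable :: "real \<Rightarrow> real \<Rightarrow> (real \<Rightarrow> real) set" where
  "square_integrable a b =
     {f. f \<in> borel_measurable (lebesgue_on {a..b}) \<and>
         integrable (lebesgue_on {a..b}) (\<lambda>x. (f x)\<^sup>2)}"

text \<open>
  There is no type for the space of classes of square integrable functions on an interval with
  variable end points.  Here the points of the type \<open>'h\<close> play the role of these classes:
  \<open>J u\<close> is a representative of the class \<open>u\<close>, every square integrable
  function represents some class, and the vector space operations and the inner product
  of \<open>'h\<close> are the usual ones.  Distinct points represent distinct classes because the
  inner product of \<open>'h\<close> is definite.
\<close>

definition is_L2 :: "real \<Rightarrow> real \<Rightarrow> ('h::{real_inner,complete_space} \<Rightarrow> real \<Rightarrow> real) \<Rightarrow> bool" where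
  "is_L2 a b J \<longleftrightarrow>
     range J \<subseteq> square_integrable a b \<and>
     (\<forall>f\<in>square_integrable a b. \<exists>u. AE x in lebesgue_on {a..b}. J u x = f x) \<and>
     (\<forall>u v. AE x in lebesgue_on {a..b}. J (u + v) x = J u x + J v x) \<and>
     (\<forall>c u. AE x in lebesgue_on {a..b}. J (c *\<^sub>R u) x = c * J u x) \<and>
     (\<forall>u v. inner u v = (LINT x|lebesgue_on {a..b}. J u x * J v x))"


section \<open>Operators\<close>

definition orthonormal_basis :: "(nat \<Rightarrow> 'h::real_inner) \<Rightarrow> bool" where
  "orthonormal_basis e \<longleftrightarrow>
     (\<forall>i j. inner (e i) (e j) = (if i = j then 1 else 0)) \<and> closure (span (range e)) = UNIV"

definition self_adjoint :: "('h::real_inner \<Rightarrow> 'h) \<Rightarrow> bool" where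
  "self_adjoint T \<longleftrightarrow> bounded_linear T \<and> (\<forall>u v. inner (T u) v = inner u (T v))"

definition nonneg_operator :: "('h::real_inner \<Rightarrow> 'h) \<Rightarrow> bool" where
  "nonneg_operator T \<longleftrightarrow> self_adjoint T \<and> (\<forall>u. 0 \<le> inner (T u) u)"

definition compact_operator :: "('h::real_normed_vector \<Rightarrow> 'h) \<Rightarrow> bool" where
  "compact_operator T \<longleftrightarrow> bounded_linear T \<and> compact (closure (T ` cball 0 1))"

text \<open>
  A nonnegative operator \<open>T\<close> is its own absolute value, so it is of trace class when the series
  of the \<open>inner (T (e k)) (e k)\<close> converges for an orthonormal basis \<open>e\<close>.  Whether it does is
  independent of the basis.
\<close>

definition nonneg_trace_class :: "('h::real_inner \<Rightarrow> 'h) \<Rightarrow> bool" where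
  "nonneg_trace_class T \<longleftrightarrow> nonneg_operator T \<and>
     (\<exists>e. orthonormal_basis e \<and> summable (\<lambda>k. inner (T (e k)) (e k)))"


section \<open>Gaussian weak random variables\<close>

text \<open>The constant 0 counts as a (degenerate) Gaussian random variable.\<close>

definition centered_gaussian :: "'w measure \<Rightarrow> ('w \<Rightarrow> real) \<Rightarrow> bool" where
  "centered_gaussian M Y \<longleftrightarrow> Y \<in> borel_measurable M \<and>
     ((AE w in M. Y w = 0) \<or>
      (\<exists>\<sigma>>0. distributed M lborel Y (\<lambda>x. ennreal (normal_density 0 \<sigma> x))))"

text \<open>
  \<open>X v\<close> is the random variable written $(X,v)$.  Linearity in \<open>v\<close> is an
  identity between random variables, hence holds almost surely.  Joint Gaussianity
  means that all finite linear combinations are Gaussian.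
\<close>

definition gaussian_weak_rv ::
    "'w measure \<Rightarrow> ('h::real_inner \<Rightarrow> 'w \<Rightarrow> real) \<Rightarrow> ('h \<Rightarrow> 'h) \<Rightarrow> bool" where
  "gaussian_weak_rv M X R \<longleftrightarrow>
     nonneg_operator R \<and>
     (\<forall>v. X v \<in> borel_measurable M) \<and>
     (\<forall>u v. AE w in M. X (u + v) w = X u w + X v w) \<and>
     (\<forall>c v. AE w in M. X (c *\<^sub>R v) w = c * X v w) \<and>
     (\<forall>F c. finite F \<longrightarrow> centered_gaussian M (\<lambda>w. \<Sum>v\<in>F. c v * X v w)) \<and>
     (\<forall>u v. has_bochner_integral M (\<lambda>w. X u w * X v w) (inner (R u) v))"

definition indep_weak_rv ::
    "'w measure \<Rightarrow> ('h \<Rightarrow> 'w \<Rightarrow> real) \<Rightarrow> ('h \<Rightarrow> 'w \<Rightarrow> real) \<Rightarrow> bool" where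
  "indep_weak_rv M X Y \<longleftrightarrow>
     prob_space.indep_var M (PiM UNIV (\<lambda>_. borel)) (\<lambda>w v. X v w)
                            (PiM UNIV (\<lambda>_. borel)) (\<lambda>w v. Y v w)"

text \<open>
  In general $(TX,v) = (X,T^*v)$; this definition is for self-adjoint \<open>T\<close>.
\<close>

definition op_weak :: "('h \<Rightarrow> 'h) \<Rightarrow> ('h \<Rightarrow> 'w \<Rightarrow> real) \<Rightarrow> 'h \<Rightarrow> 'w \<Rightarrow> real" where
  "op_weak T X = (\<lambda>v. X (T v))"

text \<open>
  A weak random variable has no pointwise norm, so its squared norm is given by the Parseval sum,
  with values in the extended nonnegative reals.
\<close>

definition weak_norm_sq :: "(nat \<Rightarrow> 'h) \<Rightarrow> ('h \<Rightarrow> 'w \<Rightarrow> real) \<Rightarrow> 'w \<Rightarrow> ennreal" where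
  "weak_norm_sq e X w = (\<Sum>k. ennreal ((X (e k) w)\<^sup>2))"


section \<open>The truncated inverse and its mean square error\<close>

text \<open>
  Indices start at 0: index \<open>k\<close> is the number \<open>k + 1\<close> of the usual enumeration from 1, so the set
  of the first \<open>n\<close> indices is \<open>{..<n}\<close>.
\<close>

definition index_set ::
    "(nat \<Rightarrow> real) \<Rightarrow> (nat \<Rightarrow> real) \<Rightarrow> (nat \<Rightarrow> real) \<Rightarrow> real \<Rightarrow> nat set" where
  "index_set lam \<rho> \<nu> \<epsilon> = {k. lam k * \<rho> k \<ge> \<epsilon> * \<nu> k}"

definition cutoff :: "(nat \<Rightarrow> real) \<Rightarrow> (nat \<Rightarrow> real) \<Rightarrow> (nat \<Rightarrow> real) \<Rightarrow> real \<Rightarrow> nat" where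
  "cutoff lam \<rho> \<nu> \<epsilon> = (THE n. index_set lam \<rho> \<nu> \<epsilon> = {..<n})"

definition truncated_inverse ::
    "(nat \<Rightarrow> real) \<Rightarrow> (nat \<Rightarrow> 'h::real_inner) \<Rightarrow> nat \<Rightarrow> 'h \<Rightarrow> 'h" where
  "truncated_inverse lam \<psi> n u = (\<Sum>k<n. (inner u (\<psi> k) / lam k) *\<^sub>R \<psi> k)"

definition mean_square_error ::
    "'w measure \<Rightarrow> (nat \<Rightarrow> 'h) \<Rightarrow> ('h \<Rightarrow> 'w \<Rightarrow> real) \<Rightarrow> ('h \<Rightarrow> 'w \<Rightarrow> real) \<Rightarrow> ('h \<Rightarrow> 'h) \<Rightarrow> ennreal" where
  "mean_square_error M e \<xi> \<eta> B =
     (\<integral>\<^sup>+ w. weak_norm_sq e (\<lambda>v w. \<xi> v w - op_weak B \<eta> v w) w \<partial>M)"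

lemma cutoff_index_set:
  assumes eps: "\<epsilon> > 0" and nu: "\<And>k. \<nu> k > 0"
    and dec: "decseq (\<lambda>k. lam k * \<rho> k / \<nu> k)"
    and lim: "(\<lambda>k. lam k * \<rho> k / \<nu> k) \<longlonglongrightarrow> 0"
  shows "index_set lam \<rho> \<nu> \<epsilon> = {..<cutoff lam \<rho> \<nu> \<epsilon>}"
proof -
  let ?r = "\<lambda>k. lam k * \<rho> k / \<nu> k"
  have I: "index_set lam \<rho> \<nu> \<epsilon> = {k. ?r k \<ge> \<epsilon>}"
    unfolding index_set_def using nu by (simp add: pos_le_divide_eq)
  have "\<forall>\<^sub>F k in sequentially. ?r k < \<epsilon>"
    using lim eps by (rule order_tendstoD)
  then have ex: "\<exists>k. ?r k < \<epsilon>"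
    by (auto simp: eventually_sequentially)
  define n where "n = (LEAST k. ?r k < \<epsilon>)"
  have n: "?r n < \<epsilon>"
    unfolding n_def using ex by (rule LeastI_ex)
  have "\<epsilon> \<le> ?r k \<longleftrightarrow> k < n" for k
  proof
    assume "\<epsilon> \<le> ?r k"
    with n decseqD[OF dec, of n k] show "k < n" by (meson leD le_less_trans not_le_imp_less)
  next
    assume "k < n"
    then show "\<epsilon> \<le> ?r k" unfolding n_def using not_less_Least leI by blast
  qed
  then have *: "index_set lam \<rho> \<nu> \<epsilon> = {..<n}"
    unfolding I by auto
  then have "cutoff lam \<rho> \<nu> \<epsilon> = n"
    unfolding cutoff_def by (intro the_equality) auto
  with * show ?thesis by simp
qed

lemma truncated_inverse_basis:
  assumes "orthonormal_basis \<psi>"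
  shows "truncated_inverse lam \<psi> n (\<psi> k) = (if k < n then inverse (lam k) *\<^sub>R \<psi> k else 0)"
proof -
  have "truncated_inverse lam \<psi> n (\<psi> k) =
      (\<Sum>j<n. if k = j then inverse (lam k) *\<^sub>R \<psi> k else 0)"
    unfolding truncated_inverse_def
    using assms by (intro sum.cong) (auto simp: orthonormal_basis_def inverse_eq_divide)
  then show ?thesis by simp
qed

lemma self_adjoint_truncated_inverse: "self_adjoint (truncated_inverse lam \<psi> n)"
proof -
  have "bounded_linear (\<lambda>u. \<Sum>k<n. (inner u (\<psi> k) / lam k) *\<^sub>R \<psi> k)"
    by (intro bounded_linear_sum bounded_linear_scaleR_const[OF
          bounded_linear_compose[OF bounded_linear_divide]] bounded_linear_inner_left)
  moreover have "inner (truncated_inverse lam \<psi> n u) v = inner u (truncated_inverse lam \<psi> n v)" for u v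
    by (simp add: truncated_inverse_def inner_sum_left inner_sum_right inner_commute mult.commute)
  ultimately show ?thesis
    by (simp add: self_adjoint_def truncated_inverse_def[abs_def])
qed

end

theory Submission
  imports Defs
begin

text \<open>
  In the eigenbasis everything decouples.  Each basis vector \<open>\<psi> k\<close> with \<open>k\<close> below the cut-off
  contributes to the error only the amplified noise \<open>- \<zeta> (\<psi> k) / lam k\<close>, of variance
  \<open>(\<epsilon> * \<nu> k / lam k)\<^sup>2\<close>; each later one contributes the discarded signal, of variance \<open>(\<rho> k)\<^sup>2\<close>.
  The quotient of the second by the first decreases in \<open>k\<close>, and the cut-off is placed exactly
  where the first overtakes the second, so the mean square error is the series of the smaller of
  the two:
  \<open>(\<Sum>k. min ((\<rho> k)\<^sup>2) ((\<epsilon> * \<nu> k / lam k)\<^sup>2))\<close>.  Every term of this series tends to 0 with \<open>\<epsilon>\<close> and is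
  dominated by \<open>(\<rho> k)\<^sup>2\<close>, independently of \<open>\<epsilon>\<close>.  If \<open>(\<Sum>k. (\<rho> k)\<^sup>2)\<close> converges, dominated
  convergence for series (Tannery's theorem) shows that the error tends to 0.

  Convergence of \<open>(\<Sum>k. (\<rho> k)\<^sup>2)\<close> is where the trace class condition enters.  That condition gives the
  convergence of the trace series along some orthonormal basis \<open>e\<close>, perhaps not along \<open>\<psi>\<close>.  The
  usual passage between bases writes the operator as a square \<open>S\<^sup>* S\<close>.  Here the random
  variable \<open>\<xi>\<close> itself serves as such a square root, since \<open>inner (R u) v\<close> is the \<open>L\<^sup>2\<close> inner product of
  \<open>\<xi> u\<close> and \<open>\<xi> v\<close>: applying Bessel's inequality for \<open>\<psi>\<close> to the random vectors
  \<open>(\<Sum>k<m. \<xi> (e k) *\<^sub>R e k)\<close>, taking expectations, and letting \<open>m\<close> grow bounds the trace series along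
  \<open>\<psi>\<close> by the one along \<open>e\<close>.
\<close>

section \<open>Orthonormal expansions\<close>

definition orthonormal :: "(nat \<Rightarrow> 'h::real_inner) \<Rightarrow> bool" where
  "orthonormal e \<longleftrightarrow> (\<forall>i j. inner (e i) (e j) = (if i = j then 1 else 0))"

definition partial_expansion :: "(nat \<Rightarrow> 'h::real_inner) \<Rightarrow> nat \<Rightarrow> 'h \<Rightarrow> 'h" where
  "partial_expansion e m u = (\<Sum>k<m. inner u (e k) *\<^sub>R e k)"

lemma inner_orthonormal_sum_left:
  assumes "orthonormal e"
  shows "inner (\<Sum>k<m. c k *\<^sub>R e k) (e j) = (if j < m then c j else 0)"
proof -
  have "inner (\<Sum>k<m. c k *\<^sub>R e k) (e j) = (\<Sum>k<m. if k = j then c j else 0)"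
    unfolding inner_sum_left using assms
    by (intro sum.cong) (auto simp: orthonormal_def)
  then show ?thesis by simp
qed

lemma norm_orthonormal_sum:
  assumes "orthonormal e"
  shows "(norm (\<Sum>k<m. c k *\<^sub>R e k))\<^sup>2 = (\<Sum>k<m. (c k)\<^sup>2)"
proof -
  have "inner (\<Sum>k<m. c k *\<^sub>R e k) (\<Sum>k<m. c k *\<^sub>R e k)
      = (\<Sum>j<m. c j * inner (\<Sum>k<m. c k *\<^sub>R e k) (e j))"
    by (subst inner_sum_right) simp
  also have "\<dots> = (\<Sum>k<m. (c k)\<^sup>2)"
    by (intro sum.cong) (simp_all add: inner_orthonormal_sum_left[OF assms] power2_eq_square)
  finally show ?thesis by (simp add: power2_norm_eq_inner)
qed

lemma norm_diff_partial_expansion: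
  assumes "orthonormal e"
  shows "(norm (u - partial_expansion e m u))\<^sup>2 = (norm u)\<^sup>2 - (\<Sum>k<m. (inner u (e k))\<^sup>2)"
proof -
  have "(norm (partial_expansion e m u))\<^sup>2 = (\<Sum>k<m. (inner u (e k))\<^sup>2)"
    unfolding partial_expansion_def by (rule norm_orthonormal_sum[OF assms])
  moreover have "inner u (partial_expansion e m u) = (\<Sum>k<m. (inner u (e k))\<^sup>2)"
    by (simp add: partial_expansion_def inner_sum_right power2_eq_square)
  ultimately show ?thesis
    by (simp add: power2_norm_eq_inner inner_diff_left inner_diff_right inner_commute)
qed

lemma bessel_inequality:
  assumes "orthonormal e"
  shows "(\<Sum>k<m. (inner u (e k))\<^sup>2) \<le> (norm u)\<^sup>2"
  using norm_diff_partial_expansion[OF assms, of u m] zero_le_power2[of "norm (u - partial_expansion e m u)"]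
  by linarith

lemma partial_expansion_diff:
  "partial_expansion e m (u - v) = partial_expansion e m u - partial_expansion e m v"
  by (simp add: partial_expansion_def inner_diff_left scaleR_diff_left sum_subtractf)

lemma partial_expansion_eq_on_span:
  assumes "orthonormal e" and "s \<in> span (range e)"
  shows "\<forall>\<^sub>F m in sequentially. partial_expansion e m s = s"
  using assms(2)
proof (induction rule: span_induct_alt)
  case base
  show ?case by (simp add: partial_expansion_def)
next
  case (step c x y)
  then obtain j where j: "x = e j" by auto
  have "\<forall>\<^sub>F m in sequentially. j < m" by (rule eventually_gt_at_top)
  with step.IH show ?case
  proof eventually_elim
    case (elim m)
    have "partial_expansion e m x = (\<Sum>k<m. if k = j then e j else 0)"
      unfolding partial_expansion_def using assms(1)
      by (intro sum.cong) (auto simp: orthonormal_def j)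
    with elim have "partial_expansion e m x = x" by (simp add: j)
    moreover have "partial_expansion e m (c *\<^sub>R x + y)
        = c *\<^sub>R partial_expansion e m x + partial_expansion e m y"
      by (simp add: partial_expansion_def inner_add_left scaleR_add_left sum.distrib scaleR_sum_right)
    ultimately show ?case using elim by simp
  qed
qed

text \<open>
  An element \<open>s\<close> of the span close to \<open>u\<close> is eventually reproduced by its expansion, and taking the
  remainder of the expansion does not increase the norm of \<open>u - s\<close>.
\<close>

lemma partial_expansion_tendsto:
  assumes "orthonormal_basis e"
  shows "(\<lambda>m. partial_expansion e m u) \<longlonglongrightarrow> u"
proof (rule LIMSEQ_I)
  fix r :: real assume "0 < r"
  have on: "orthonormal e" and dense: "u \<in> closure (span (range e))"
    using assms by (auto simp: orthonormal_basis_def orthonormal_def)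
  obtain s where s: "s \<in> span (range e)" "norm (u - s) < r"
    using dense \<open>0 < r\<close> by (metis closure_approachable dist_norm norm_minus_commute)
  obtain m0 where m0: "\<And>m. m \<ge> m0 \<Longrightarrow> partial_expansion e m s = s"
    using partial_expansion_eq_on_span[OF on s(1)] by (auto simp: eventually_sequentially)
  have "norm (partial_expansion e m u - u) < r" if "m \<ge> m0" for m
  proof -
    have "u - partial_expansion e m u = (u - s) - partial_expansion e m (u - s)"
      by (simp add: partial_expansion_diff m0[OF that])
    moreover have "(norm ((u - s) - partial_expansion e m (u - s)))\<^sup>2 \<le> (norm (u - s))\<^sup>2"
      by (simp add: norm_diff_partial_expansion[OF on] sum_nonneg)
    ultimately have "norm (u - partial_expansion e m u) \<le> norm (u - s)"
      by (metis norm_ge_zero power2_le_imp_le)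
    with s(2) show ?thesis by (simp add: norm_minus_commute)
  qed
  then show "\<exists>no. \<forall>m\<ge>no. norm (partial_expansion e m u - u) < r" by blast
qed

section \<open>The trace along another orthonormal system\<close>

lemma quadratic_form_partial_expansion:
  assumes "bounded_linear R"
  shows "inner (R (partial_expansion e m u)) (partial_expansion e m u)
    = (\<Sum>k<m. \<Sum>l<m. inner (e k) u * inner (e l) u * inner (R (e k)) (e l))"
proof -
  interpret bounded_linear R by fact
  show ?thesis
    by (simp add: partial_expansion_def sum scaleR inner_sum_left inner_sum_right sum_distrib_left
        inner_commute[of u] mult_ac) (subst sum.swap, simp add: mult_ac)
qed

text \<open>
  The second moments make \<open>u \<mapsto> X u\<close>, as a map into square integrable random variables, a
  factorization of \<open>R\<close> that stands in for its square root.
  Bessel's inequality holds for each realization of the random vector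
  \<open>(\<Sum>k<m. X (e k) *\<^sub>R e k)\<close>, and its expectation is the assertion.
\<close>

lemma covariance_truncated_trace_le:
  fixes X :: "'h::real_inner \<Rightarrow> 'w \<Rightarrow> real"
  assumes R: "bounded_linear R"
    and cov: "\<And>u v. has_bochner_integral M (\<lambda>w. X u w * X v w) (inner (R u) v)"
    and e: "orthonormal e" and f: "orthonormal f"
  shows "(\<Sum>j<n. inner (R (partial_expansion e m (f j))) (partial_expansion e m (f j)))
    \<le> (\<Sum>k<m. inner (R (e k)) (e k))"
proof -
  define Z where "Z w = (\<Sum>k<m. X (e k) w *\<^sub>R e k)" for w
  have sq: "(inner (Z w) (f j))\<^sup>2 =
      (\<Sum>k<m. \<Sum>l<m. inner (e k) (f j) * inner (e l) (f j) * (X (e k) w * X (e l) w))" for w j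
    by (simp add: Z_def inner_sum_left power2_eq_square sum_product mult_ac)
  have "has_bochner_integral M (\<lambda>w. (inner (Z w) (f j))\<^sup>2)
      (inner (R (partial_expansion e m (f j))) (partial_expansion e m (f j)))" for j
    unfolding sq quadratic_form_partial_expansion[OF R]
    by (intro has_bochner_integral_sum has_bochner_integral_mult_right cov)
  then have lhs: "has_bochner_integral M (\<lambda>w. \<Sum>j<n. (inner (Z w) (f j))\<^sup>2)
      (\<Sum>j<n. inner (R (partial_expansion e m (f j))) (partial_expansion e m (f j)))"
    by (intro has_bochner_integral_sum)
  have rhs: "has_bochner_integral M (\<lambda>w. \<Sum>k<m. X (e k) w * X (e k) w) (\<Sum>k<m. inner (R (e k)) (e k))"
    by (intro has_bochner_integral_sum cov)
  have "(\<Sum>j<n. (inner (Z w) (f j))\<^sup>2) \<le> (\<Sum>k<m. X (e k) w * X (e k) w)" for w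
    using bessel_inequality[OF f, of "Z w" n] norm_orthonormal_sum[OF e, of "\<lambda>k. X (e k) w" m]
    by (simp add: Z_def power2_eq_square)
  then show ?thesis
    using integral_mono[of M "\<lambda>w. \<Sum>j<n. (inner (Z w) (f j))\<^sup>2" "\<lambda>w. \<Sum>k<m. X (e k) w * X (e k) w"]
      lhs rhs by (simp add: has_bochner_integral_iff)
qed

text \<open>
  Continuity of the quadratic form lets \<open>m\<close> tend to infinity in the truncated bound while \<open>n\<close> stays
  fixed, so the partial sums along \<open>f\<close> are bounded by the full trace along \<open>e\<close>.
\<close>

lemma covariance_trace_summable:
  fixes X :: "'h::real_inner \<Rightarrow> 'w \<Rightarrow> real"
  assumes R: "nonneg_trace_class R"
    and cov: "\<And>u v. has_bochner_integral M (\<lambda>w. X u w * X v w) (inner (R u) v)"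
    and f: "orthonormal f"
  shows "summable (\<lambda>j. inner (R (f j)) (f j))"
proof -
  obtain e where e: "orthonormal_basis e" and summ: "summable (\<lambda>k. inner (R (e k)) (e k))"
    using R by (auto simp: nonneg_trace_class_def)
  have bl: "bounded_linear R" and nn: "\<And>u. 0 \<le> inner (R u) u"
    using R by (auto simp: nonneg_trace_class_def nonneg_operator_def self_adjoint_def)
  have on: "orthonormal e"
    using e by (simp add: orthonormal_basis_def orthonormal_def)
  have "(\<Sum>j<n. inner (R (f j)) (f j)) \<le> (\<Sum>k. inner (R (e k)) (e k))" for n
  proof (rule LIMSEQ_le_const2)
    show "(\<lambda>m. \<Sum>j<n. inner (R (partial_expansion e m (f j))) (partial_expansion e m (f j)))
        \<longlonglongrightarrow> (\<Sum>j<n. inner (R (f j)) (f j))"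
      by (intro tendsto_sum tendsto_inner bounded_linear.tendsto[OF bl]
          partial_expansion_tendsto[OF e])
    show "\<exists>N. \<forall>m\<ge>N. (\<Sum>j<n. inner (R (partial_expansion e m (f j))) (partial_expansion e m (f j)))
        \<le> (\<Sum>k. inner (R (e k)) (e k))"
      using order_trans[OF covariance_truncated_trace_le[OF bl cov on f] sum_le_suminf[OF summ]] nn
      by blast
  qed
  then show ?thesis
    by (intro summableI_nonneg_bounded nn)
qed

section \<open>The mean square error of the truncated inverse\<close>

lemma gaussian_weak_rv_cov:
  assumes "gaussian_weak_rv M X R"
  shows "has_bochner_integral M (\<lambda>w. X u w * X v w) (inner (R u) v)"
  using assms by (simp add: gaussian_weak_rv_def)

lemma gaussian_weak_rv_second_moment:
  assumes "gaussian_weak_rv M X R"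
  shows "(\<integral>\<^sup>+ w. ennreal ((X u w)\<^sup>2) \<partial>M) = ennreal (inner (R u) u)"
  using gaussian_weak_rv_cov[OF assms, of u u]
  by (simp add: has_bochner_integral_iff nn_integral_eq_integral power2_eq_square)

lemma gaussian_weak_rv_zero:
  assumes "gaussian_weak_rv M X R"
  shows "AE w in M. X 0 w = 0"
proof -
  have "AE w in M. X (0 *\<^sub>R 0) w = 0 * X 0 w"
    using assms unfolding gaussian_weak_rv_def by blast
  then show ?thesis by simp
qed

text \<open>
  At a basis vector below the cut-off, the truncated inverse \<open>B\<close> inverts \<open>A\<close> and the signal
  cancels identically; at a later one \<open>B\<close> vanishes and the whole signal is lost.  Either way a
  single variance survives, and the Parseval series of the squared error may be integrated term by
  term because its terms are nonnegative.
\<close>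

lemma mean_square_error_truncated_inverse:
  fixes \<xi> \<zeta> :: "'h::real_inner \<Rightarrow> 'w \<Rightarrow> real"
  assumes \<psi>: "orthonormal_basis \<psi>"
    and A: "bounded_linear A" "\<And>k. A (\<psi> k) = lam k *\<^sub>R \<psi> k" "\<And>k. lam k \<noteq> 0"
    and \<xi>: "gaussian_weak_rv M \<xi> R" and \<zeta>: "gaussian_weak_rv M \<zeta> S"
  shows "mean_square_error M \<psi> \<xi> (\<lambda>v w. op_weak A \<xi> v w + \<zeta> v w) (truncated_inverse lam \<psi> n)
    = (\<Sum>k. ennreal (if k < n then inner (S (\<psi> k)) (\<psi> k) / (lam k)\<^sup>2 else inner (R (\<psi> k)) (\<psi> k)))"
    (is "?mse = (\<Sum>k. ennreal (?d k))")
proof -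
  let ?B = "truncated_inverse lam \<psi> n"
  interpret A: bounded_linear A by fact
  have S: "bounded_linear S"
    using \<zeta> by (simp add: gaussian_weak_rv_def nonneg_operator_def self_adjoint_def)
  have meas: "\<xi> v \<in> borel_measurable M" "\<zeta> v \<in> borel_measurable M" for v
    using \<xi> \<zeta> by (auto simp: gaussian_weak_rv_def)
  let ?err = "\<lambda>k w. \<xi> (\<psi> k) w - (\<xi> (A (?B (\<psi> k))) w + \<zeta> (?B (\<psi> k)) w)"
  have moment: "(\<integral>\<^sup>+ w. ennreal ((?err k w)\<^sup>2) \<partial>M) = ennreal (?d k)" for k
  proof (cases "k < n")
    case True
    define u where "u = inverse (lam k) *\<^sub>R \<psi> k"
    have Bk: "?B (\<psi> k) = u"
      using truncated_inverse_basis[OF \<psi>, of lam n k] True by (simp add: u_def)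
    moreover have "A u = \<psi> k"
      using A(3)[of k] by (simp add: u_def A.scaleR A(2))
    ultimately have "(\<integral>\<^sup>+ w. ennreal ((?err k w)\<^sup>2) \<partial>M) = ennreal (inner (S u) u)"
      using gaussian_weak_rv_second_moment[OF \<zeta>, of u] by simp
    also have "inner (S u) u = ?d k"
      using True by (simp add: u_def linear_cmul[OF bounded_linear.linear[OF S]] power2_eq_square field_simps)
    finally show ?thesis .
  next
    case False
    then have Bk: "?B (\<psi> k) = 0"
      using truncated_inverse_basis[OF \<psi>, of lam n k] by simp
    have "(\<integral>\<^sup>+ w. ennreal ((?err k w)\<^sup>2) \<partial>M) = (\<integral>\<^sup>+ w. ennreal ((\<xi> (\<psi> k) w)\<^sup>2) \<partial>M)"
      using gaussian_weak_rv_zero[OF \<xi>] gaussian_weak_rv_zero[OF \<zeta>]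
      by (intro nn_integral_cong_AE) (auto simp: Bk A.zero)
    also have "\<dots> = ennreal (?d k)"
      using False gaussian_weak_rv_second_moment[OF \<xi>, of "\<psi> k"] by simp
    finally show ?thesis .
  qed
  have "?mse = (\<integral>\<^sup>+ w. (\<Sum>k. ennreal ((?err k w)\<^sup>2)) \<partial>M)"
    by (simp add: mean_square_error_def weak_norm_sq_def op_weak_def)
  also have "\<dots> = (\<Sum>k. \<integral>\<^sup>+ w. ennreal ((?err k w)\<^sup>2) \<partial>M)"
    using meas by (intro nn_integral_suminf measurable_compose[OF _ measurable_ennreal]
        borel_measurable_power borel_measurable_diff borel_measurable_add)
  finally show ?thesis by (simp only: moment)
qed

section \<open>Passing to the limit of vanishing noise\<close>

lemma suminf_min_tendsto_0:
  fixes c s :: "nat \<Rightarrow> real"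
  assumes "summable c" and nonneg: "\<And>k. 0 \<le> c k"
  shows "((\<lambda>\<epsilon>. \<Sum>k. min (c k) ((\<epsilon> * s k)\<^sup>2)) \<longlongrightarrow> 0) (at_right 0)"
proof -
  have "((\<lambda>\<epsilon>. min (c k) ((\<epsilon> * s k)\<^sup>2)) \<longlongrightarrow> min (c k) ((0 * s k)\<^sup>2)) (at_right 0)" for k
    by (intro tendsto_intros)
  then have lim: "((\<lambda>\<epsilon>. min (c k) ((\<epsilon> * s k)\<^sup>2)) \<longlongrightarrow> 0) (at_right 0)" for k
    using nonneg by simp
  have "((\<lambda>\<epsilon>. \<Sum>k. min (c k) ((\<epsilon> * s k)\<^sup>2)) \<longlongrightarrow> (\<Sum>k::nat. 0)) (at_right 0)"
    using tannerys_theorem[of "\<lambda>k \<epsilon>. min (c k) ((\<epsilon> * s k)\<^sup>2)", OF lim _ assms(1)] nonneg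
    by (auto intro!: always_eventually)
  then show ?thesis by simp
qed

theorem theorem2:
  fixes a b :: real
    and J :: "'h::{real_inner,complete_space} \<Rightarrow> real \<Rightarrow> real"
    and A R\<^sub>\<xi> N :: "'h \<Rightarrow> 'h"
    and lam \<rho> \<nu> :: "nat \<Rightarrow> real"
    and \<psi> :: "nat \<Rightarrow> 'h"
    and M :: "'w measure"
    and \<xi> :: "'h \<Rightarrow> 'w \<Rightarrow> real"
    and \<zeta> \<eta> :: "real \<Rightarrow> 'h \<Rightarrow> 'w \<Rightarrow> real"
    and k\<^sub>I :: "real \<Rightarrow> nat"
    and B :: "real \<Rightarrow> 'h \<Rightarrow> 'h"
  assumes "a < b" and "is_L2 a b J"
    and "inj A" and "self_adjoint A" and "compact_operator A"
    and "orthonormal_basis \<psi>"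
    and "\<And>k. A (\<psi> k) = lam k *\<^sub>R \<psi> k"
    and "\<And>k. {u. A u = lam k *\<^sub>R u} = span {\<psi> k}"
    and "\<And>k. 0 < lam k" and "\<And>k. lam k \<le> 1" and "lam \<longlonglongrightarrow> 0"
    and "prob_space M"
    and "gaussian_weak_rv M \<xi> R\<^sub>\<xi>"
    and "\<And>\<epsilon>. \<epsilon> > 0 \<Longrightarrow> gaussian_weak_rv M (\<zeta> \<epsilon>) (\<lambda>u. \<epsilon>\<^sup>2 *\<^sub>R N u)"
    and "\<And>\<epsilon>. \<epsilon> > 0 \<Longrightarrow> inj (\<lambda>u. \<epsilon>\<^sup>2 *\<^sub>R N u)"
    and "\<And>\<epsilon>. \<epsilon> > 0 \<Longrightarrow> indep_weak_rv M \<xi> (\<zeta> \<epsilon>)"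
    and "\<And>\<epsilon>. \<eta> \<epsilon> = (\<lambda>v w. op_weak A \<xi> v w + \<zeta> \<epsilon> v w)"
    and "\<And>k. \<rho> k > 0" and "\<And>k. (\<rho> k)\<^sup>2 = inner (R\<^sub>\<xi> (\<psi> k)) (\<psi> k)"
    and "\<And>k. \<nu> k > 0"
    and "\<And>\<epsilon> k. \<epsilon> > 0 \<Longrightarrow> \<epsilon>\<^sup>2 * (\<nu> k)\<^sup>2 = inner (\<epsilon>\<^sup>2 *\<^sub>R N (\<psi> k)) (\<psi> k)"
    and "inj (\<lambda>k. lam k * \<rho> k / \<nu> k)" and "decseq (\<lambda>k. lam k * \<rho> k / \<nu> k)"
    and "\<And>\<epsilon>. k\<^sub>I \<epsilon> = cutoff lam \<rho> \<nu> \<epsilon>"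
    and "\<And>\<epsilon>. B \<epsilon> = truncated_inverse lam \<psi> (k\<^sub>I \<epsilon>)"
    and "nonneg_trace_class R\<^sub>\<xi>"
    and "(\<lambda>k. lam k * \<rho> k / \<nu> k) \<longlonglongrightarrow> 0"
  shows "((\<lambda>\<epsilon>. mean_square_error M \<psi> \<xi> (\<eta> \<epsilon>) (B \<epsilon>)) \<longlongrightarrow> 0) (at_right 0) \<and>
         ((\<lambda>\<epsilon>. (\<Sum>k. (\<rho> (k + k\<^sub>I \<epsilon>))\<^sup>2) + (\<Sum>k<k\<^sub>I \<epsilon>. (\<epsilon> * \<nu> k / lam k)\<^sup>2)) \<longlongrightarrow> 0) (at_right 0)"
proof -
  define s where "s k = \<nu> k / lam k" for k
  define d where "d \<epsilon> k = min ((\<rho> k)\<^sup>2) ((\<epsilon> * s k)\<^sup>2)" for \<epsilon> k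
  have "orthonormal \<psi>"
    using assms(6) by (simp add: orthonormal_basis_def orthonormal_def)
  then have "summable (\<lambda>k. inner (R\<^sub>\<xi> (\<psi> k)) (\<psi> k))"
    using covariance_trace_summable[OF assms(26) gaussian_weak_rv_cov[OF assms(13)]] by blast
  then have summ: "summable (\<lambda>k. (\<rho> k)\<^sup>2)"
    by (simp add: assms(19))
  have summ_d: "summable (d \<epsilon>)" for \<epsilon>
    by (rule summable_comparison_test[OF _ summ]) (auto simp: d_def)
  have below: "k < k\<^sub>I \<epsilon> \<longleftrightarrow> \<epsilon> * s k \<le> \<rho> k" if "\<epsilon> > 0" for \<epsilon> k
  proof -
    have "index_set lam \<rho> \<nu> \<epsilon> = {..<k\<^sub>I \<epsilon>}"
      using cutoff_index_set[OF that assms(20) assms(23) assms(27)] by (simp add: assms(24))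
    then have "k < k\<^sub>I \<epsilon> \<longleftrightarrow> \<epsilon> * \<nu> k \<le> lam k * \<rho> k"
      by (auto simp: index_set_def)
    then show ?thesis
      using assms(9)[of k] by (simp add: s_def pos_divide_le_eq mult.commute)
  qed
  have d_eq: "d \<epsilon> k = (if k < k\<^sub>I \<epsilon> then (\<epsilon> * \<nu> k / lam k)\<^sup>2 else (\<rho> k)\<^sup>2)" if "\<epsilon> > 0" for \<epsilon> k
  proof -
    have "0 \<le> \<epsilon> * s k" "0 \<le> \<rho> k"
      using that assms(9,18,20)[of k] by (auto simp: s_def intro: less_imp_le)
    then have "(\<epsilon> * s k)\<^sup>2 \<le> (\<rho> k)\<^sup>2 \<longleftrightarrow> k < k\<^sub>I \<epsilon>"
      using below[OF that] by (simp add: power_mono_iff)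
    then show ?thesis by (auto simp: d_def s_def)
  qed
  have series: "(\<Sum>k. (\<rho> (k + k\<^sub>I \<epsilon>))\<^sup>2) + (\<Sum>k<k\<^sub>I \<epsilon>. (\<epsilon> * \<nu> k / lam k)\<^sup>2) = suminf (d \<epsilon>)"
    if "\<epsilon> > 0" for \<epsilon>
    using suminf_split_initial_segment[OF summ_d, of \<epsilon> "k\<^sub>I \<epsilon>"] by (simp add: d_eq[OF that])
  have mse: "mean_square_error M \<psi> \<xi> (\<eta> \<epsilon>) (B \<epsilon>) = ennreal (suminf (d \<epsilon>))" if "\<epsilon> > 0" for \<epsilon>
  proof -
    have "bounded_linear A" and "\<And>k. lam k \<noteq> 0"
      using assms(4,9) by (auto simp: self_adjoint_def less_le)
    note mean_square_error_truncated_inverse[OF assms(6) this(1) assms(7) this(2) assms(13)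
        assms(14)[OF that], of "k\<^sub>I \<epsilon>"]
    moreover have "(if k < k\<^sub>I \<epsilon> then inner (\<epsilon>\<^sup>2 *\<^sub>R N (\<psi> k)) (\<psi> k) / (lam k)\<^sup>2
        else inner (R\<^sub>\<xi> (\<psi> k)) (\<psi> k)) = d \<epsilon> k" for k
      by (simp only: d_eq[OF that] assms(21)[OF that, symmetric] assms(19)[symmetric]
          power_mult_distrib power_divide)
    ultimately have "mean_square_error M \<psi> \<xi> (\<eta> \<epsilon>) (B \<epsilon>) = (\<Sum>k. ennreal (d \<epsilon> k))"
      by (simp only: assms(17,25))
    also have "\<dots> = ennreal (suminf (d \<epsilon>))"
      by (rule suminf_ennreal2[OF _ summ_d]) (simp add: d_def)
    finally show ?thesis .
  qed
  have lim: "((\<lambda>\<epsilon>. suminf (d \<epsilon>)) \<longlongrightarrow> 0) (at_right 0)"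
    unfolding d_def by (rule suminf_min_tendsto_0[OF summ]) simp
  have pos: "\<forall>\<^sub>F \<epsilon> in at_right (0::real). \<epsilon> > 0"
    by (simp add: eventually_at_right_less)
  have "((\<lambda>\<epsilon>. ennreal (suminf (d \<epsilon>))) \<longlongrightarrow> 0) (at_right 0)"
    using tendsto_ennrealI[OF lim] by simp
  then show ?thesis
    using lim pos mse series
    by (intro conjI; elim Lim_transform_eventually) (auto elim: eventually_mono)
qed

end
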